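(* Let $\triangle ABC$ be a (nondegenerate) triangle in the Euclidean plane, with circumradius $R$ and nine-point center $N$. Let $I_c$ be the excenter opposite $C$ and let $r_c$ be the corresponding exradius. Then $$|I_cN| = \tfrac12 R + r_c.$$
   Context: $|XY|$ denotes the Euclidean distance between points $X$ and $Y$. The circumradius $R$ is the radius of the circle through $A,B,C$. The excenter $I_c$ opposite $C$ is the intersection point of the external angle bisectors of the triangle at $A$ and at $B$. The exradius $r_c$ is the radius of the excircle opposite $C$, i.e. the circle centered at $I_c$ which is tangent to the side $AB$ and to the lines $CA$ and $CB$. The nine-point center $N$ is the center of the nine-point circle, i.e. the circle passing through the midpoints of the three sides of the triangle; its radius is $\tfrac12 R$. *)

theory Defs
  imports "HOL-Analysis.Analysis"
begin

type_synonym point = "real ^ 2"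

text \<open>Unoriented angle \<open>\<angle>XOY\<close>, with values in \<open>[0, \<pi>]\<close>; meaningful for \<open>X \<noteq> O\<close> and \<open>Y \<noteq> O\<close>.\<close>

definition angle_at :: "point \<Rightarrow> point \<Rightarrow> point \<Rightarrow> real" where
  "angle_at X V Y = arccos (((X - V) \<bullet> (Y - V)) / (norm (X - V) * norm (Y - V)))"

definition bisector_ray :: "point \<Rightarrow> point \<Rightarrow> point \<Rightarrow> point set" where
  "bisector_ray X V Y =
     {P. P \<noteq> V \<and> angle_at X V P = angle_at X V Y / 2 \<and> angle_at P V Y = angle_at X V Y / 2}"

definition angle_bisector :: "point \<Rightarrow> point \<Rightarrow> point \<Rightarrow> point set" where
  "angle_bisector X V Y = (\<Union>P \<in> bisector_ray X V Y. affine hull {V, P})"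

text \<open>The external angle at \<open>V\<close> of the triangle \<open>XVY\<close> lies between the ray from \<open>V\<close> through \<open>X\<close>
  and the extension of the side \<open>YV\<close> beyond \<open>V\<close>; the point \<open>V + (V - Y)\<close> is on that extension.\<close>

definition external_angle_bisector :: "point \<Rightarrow> point \<Rightarrow> point \<Rightarrow> point set" where
  "external_angle_bisector X V Y = angle_bisector X V (V + (V - Y))"

text \<open>In the predicates below, the last of the three vertices is the one that the excenter or
  excircle is opposite to.\<close>

definition is_excenter :: "point \<Rightarrow> point \<Rightarrow> point \<Rightarrow> point \<Rightarrow> bool" where
  "is_excenter A B C I \<longleftrightarrow>
     external_angle_bisector B A C \<inter> external_angle_bisector A B C = {I}"

definition circle_touches_at :: "point \<Rightarrow> real \<Rightarrow> point set \<Rightarrow> point \<Rightarrow> bool" where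
  "circle_touches_at Z r L T \<longleftrightarrow> r > 0 \<and> L \<inter> sphere Z r = {T}"

definition is_excircle :: "point \<Rightarrow> point \<Rightarrow> point \<Rightarrow> point \<Rightarrow> real \<Rightarrow> bool" where
  "is_excircle A B C I r \<longleftrightarrow>
     is_excenter A B C I \<and>
     (\<exists>T. circle_touches_at I r (affine hull {A, B}) T \<and> T \<in> closed_segment A B) \<and>
     (\<exists>T. circle_touches_at I r (affine hull {C, A}) T) \<and>
     (\<exists>T. circle_touches_at I r (affine hull {C, B}) T)"

definition is_circumradius :: "point \<Rightarrow> point \<Rightarrow> point \<Rightarrow> real \<Rightarrow> bool" where
  "is_circumradius A B C R \<longleftrightarrow> (\<exists>Z. {A, B, C} \<subseteq> sphere Z R)"

definition is_nine_point_center :: "point \<Rightarrow> point \<Rightarrow> point \<Rightarrow> point \<Rightarrow> bool" where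
  "is_nine_point_center A B C N \<longleftrightarrow>
     (\<exists>\<rho>. {midpoint B C, midpoint C A, midpoint A B} \<subseteq> sphere N \<rho>)"

end

theory Submission
  imports Defs
begin

text \<open>
  The excircle opposite \<open>C\<close> rationalises the whole configuration. Use Cartesian coordinates
  whose origin is the point \<open>T\<close> where it touches \<open>AB\<close>, whose first axis is directed from \<open>A\<close> to
  \<open>B\<close>, and whose second axis points towards the excenter. With \<open>x = |AT|\<close> and \<open>y = |TB|\<close> we have
  \<open>A = (-x, 0)\<close>, \<open>B = (y, 0)\<close> and \<open>I\<^sub>c = (0, r)\<close>. The vertex \<open>C = (p, q)\<close> is the intersection of the
  second tangents from \<open>A\<close> and from \<open>B\<close>; once the trivial factor \<open>q\<close> is cancelled, tangency is
  linear in \<open>(p, q)\<close>, so \<open>C\<close> is a rational function of \<open>x, y, r\<close>. So are the circumcenter and the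
  nine-point center, being solutions of linear equations, and so is \<open>R\<close> itself, because
  with \<open>D = r\<^sup>2 - x y\<close> one finds \<open>4 r D R = D\<^sup>2 + (x + y)\<^sup>2 r\<^sup>2 = (x\<^sup>2 + r\<^sup>2) (y\<^sup>2 + r\<^sup>2)\<close>. The claim then becomes an identity of rational functions.

  Tangency does not distinguish the excircle from the incircle, for which \<open>D < 0\<close> and
  the distance is \<open>R / 2 - r\<close>. The distinction is made by the external bisector
  at \<open>A\<close>, which forces \<open>C\<close> to be on the side of \<open>AB\<close> opposite to \<open>I\<^sub>c\<close>, that is \<open>q < 0\<close> and
  \<open>D > 0\<close>. The lemma \<open>dist_excenter_nine_point_center_coords\<close> carries out the computation;
  the lemmas before it translate tangency and angle bisection into inner products.
\<close>

section \<open>Tangent lines and external bisectors in terms of inner products\<close>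

text \<open>If the radius to \<open>T\<close> were not perpendicular to the line, the reflection of \<open>T\<close> in the foot
  of the perpendicular from \<open>Z\<close> would be a second common point.\<close>

lemma circle_touches_at_orthogonal:
  assumes touch: "circle_touches_at Z r (affine hull {A, B}) T"
  shows "(T - Z) \<bullet> (B - A) = 0"
proof (cases "A = B")
  case False
  define d where "d = B - A"
  define k where "k = - 2 * ((T - Z) \<bullet> d) / (d \<bullet> d)"
  have dd: "d \<bullet> d \<noteq> 0" using False by (simp add: d_def)
  have T: "T \<in> affine hull {A, B}" and TZ: "dist Z T = r"
    using touch by (auto simp: circle_touches_at_def)
  have "T + k *\<^sub>R (B - A) \<in> affine hull {A, B}"
    using mem_affine_3_minus[OF affine_affine_hull T, of B A k]
    by (simp add: hull_inc)
  moreover have "(norm (T + k *\<^sub>R d - Z))\<^sup>2 = (norm (T - Z))\<^sup>2"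
  proof -
    have "(norm (T + k *\<^sub>R d - Z))\<^sup>2 = (norm ((T - Z) + k *\<^sub>R d))\<^sup>2"
      by (simp add: algebra_simps)
    also have "\<dots> = (norm (T - Z))\<^sup>2 + k * (2 * ((T - Z) \<bullet> d) + k * (d \<bullet> d))"
      unfolding power2_norm_eq_inner by (simp add: inner_simps inner_commute algebra_simps)
    also have "2 * ((T - Z) \<bullet> d) + k * (d \<bullet> d) = 0"
      using dd by (simp add: k_def)
    finally show ?thesis by simp
  qed
  then have "dist Z (T + k *\<^sub>R d) = r"
    using TZ by (simp add: dist_norm norm_minus_commute)
  ultimately have "T + k *\<^sub>R d \<in> affine hull {A, B} \<inter> sphere Z r"
    by (simp add: d_def)
  then have "T + k *\<^sub>R d = T"
    using touch unfolding circle_touches_at_def by blast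
  then show ?thesis using dd by (auto simp: k_def d_def)
qed simp

text \<open>Tangency expressed without the point of contact: this is Pythagoras in the triangle
  \<open>A T Z\<close>, multiplied by the square of the length of \<open>AB\<close>.\<close>

lemma circle_touches_line_inner:
  assumes touch: "circle_touches_at Z r (affine hull {A, B}) T"
  shows "((Z - A) \<bullet> (Z - A) - r\<^sup>2) * ((B - A) \<bullet> (B - A)) = ((Z - A) \<bullet> (B - A))\<^sup>2"
proof -
  obtain t where t: "T = A + t *\<^sub>R (B - A)"
    using touch unfolding circle_touches_at_def affine_hull_2_alt by auto
  define d where "d = B - A"
  define w where "w = Z - T"
  have wd: "w \<bullet> d = 0"
    using circle_touches_at_orthogonal[OF touch] by (simp add: w_def d_def inner_diff_left)
  have ww: "w \<bullet> w = r\<^sup>2"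
    using touch by (auto simp: circle_touches_at_def w_def dist_norm simp flip: power2_norm_eq_inner)
  have "Z - A = w + t *\<^sub>R d" by (simp add: w_def d_def t)
  then show ?thesis
    using wd ww by (simp add: d_def[symmetric] inner_simps inner_commute power2_eq_square)
qed

lemma angle_at_eq_iff:
  assumes "X \<noteq> V" "Y \<noteq> V" "P \<noteq> V"
  shows "angle_at X V P = angle_at P V Y \<longleftrightarrow>
    ((P - V) \<bullet> (X - V)) / norm (X - V) = ((P - V) \<bullet> (Y - V)) / norm (Y - V)"
proof -
  have bound: "\<bar>(v \<bullet> w) / (norm v * norm w)\<bar> \<le> 1" for v w :: point
    using Cauchy_Schwarz_ineq2[of v w] by (cases "norm v * norm w = 0") (auto simp: field_simps)
  have "angle_at X V P = angle_at P V Y \<longleftrightarrow>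
    ((X - V) \<bullet> (P - V)) / (norm (X - V) * norm (P - V)) =
    ((P - V) \<bullet> (Y - V)) / (norm (P - V) * norm (Y - V))"
    unfolding angle_at_def by (rule arccos_eq_iff) (use bound in auto)
  then show ?thesis
    using assms by (simp add: inner_commute field_simps)
qed

text \<open>The external bisector makes equal angles with one side and the reverse of the other. Equal
  angles with two unit vectors are equal scalar products with them, and reversing one of the
  vectors changes the sign of its scalar product.\<close>

lemma external_angle_bisector_inner:
  assumes "I \<in> external_angle_bisector X V Y" "X \<noteq> V" "Y \<noteq> V"
  shows "((I - V) \<bullet> (X - V)) / norm (X - V) = - ((I - V) \<bullet> (Y - V)) / norm (Y - V)"
proof -
  obtain P where P: "P \<in> bisector_ray X V (V + (V - Y))" and I: "I \<in> affine hull {V, P}"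
    using assms(1) by (auto simp: external_angle_bisector_def angle_bisector_def)
  obtain t where "I = V + t *\<^sub>R (P - V)"
    using I unfolding affine_hull_2_alt by blast
  then have t: "I - V = t *\<^sub>R (P - V)" by simp
  have "((P - V) \<bullet> (X - V)) / norm (X - V) = ((P - V) \<bullet> (V - Y)) / norm (V - Y)"
    using P angle_at_eq_iff[of X V "V + (V - Y)" P] assms(2,3) by (simp add: bisector_ray_def)
  also have "(P - V) \<bullet> (V - Y) = - ((P - V) \<bullet> (Y - V))"
    by (simp add: inner_diff_right)
  finally have "((P - V) \<bullet> (X - V)) / norm (X - V) = - ((P - V) \<bullet> (Y - V)) / norm (Y - V)"
    by (simp add: norm_minus_commute)
  then have "t * (((P - V) \<bullet> (X - V)) / norm (X - V)) = t * (- ((P - V) \<bullet> (Y - V)) / norm (Y - V))"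
    by (rule arg_cong)
  then show ?thesis by (simp add: t)
qed

section \<open>Coordinates with respect to an orthonormal pair\<close>

lemma inner_orthonormal_real2:
  fixes e n v w :: "real ^ 2"
  assumes "e \<bullet> e = 1" "n \<bullet> n = 1" "e \<bullet> n = 0"
  shows "v \<bullet> w = (v \<bullet> e) * (w \<bullet> e) + (v \<bullet> n) * (w \<bullet> n)"
proof -
  define \<delta> where "\<delta> = e $ 1 * n $ 2 - e $ 2 * n $ 1"
  have ee: "e $ 1 * e $ 1 + e $ 2 * e $ 2 = 1" and nn: "n $ 1 * n $ 1 + n $ 2 * n $ 2 = 1"
    and en: "e $ 1 * n $ 1 + e $ 2 * n $ 2 = 0"
    using assms by (simp_all add: inner_vec_def sum_2)
  \<comment> \<open>\<open>n\<close> is \<open>e\<close> turned by a right angle, in the direction given by the sign \<open>\<delta>\<close>.\<close>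
  have n1: "n $ 1 = - \<delta> * e $ 2" and n2: "n $ 2 = \<delta> * e $ 1"
    using ee en unfolding \<delta>_def by algebra+
  have \<delta>: "\<delta> * \<delta> = 1"
    using nn ee unfolding n1 n2 by algebra
  show ?thesis
    unfolding inner_vec_def sum_2 inner_real_def n1 n2 using ee \<delta> by algebra
qed

section \<open>The computation\<close>

text \<open>Here \<open>(z\<^sub>1, z\<^sub>2)\<close> is the circumcenter and \<open>(n\<^sub>1, n\<^sub>2)\<close> the nine-point center; the hypotheses on
  tangency and on the bisector have the form in which the inner product lemmas yield them for the
  lines \<open>AC\<close> and \<open>BC\<close> and for the bisector at \<open>A\<close>. The contact point on \<open>AB\<close> is allowed to be a
  vertex, and \<open>external\<close> is asked only for \<open>x > 0\<close>, because the two tangencies themselves imply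
  that \<open>x\<close> and \<open>y\<close> are positive.\<close>

lemma dist_excenter_nine_point_center_coords:
  fixes x y r p q z\<^sub>1 z\<^sub>2 n\<^sub>1 n\<^sub>2 R \<rho> :: real
  assumes x: "x \<ge> 0" and y: "y \<ge> 0" and xy: "x + y > 0" and r: "r > 0" and q: "q \<noteq> 0" and R: "R \<ge> 0"
    and tangentA: "x\<^sup>2 * ((p + x)\<^sup>2 + q\<^sup>2) = (x * (p + x) + r * q)\<^sup>2"
    and tangentB: "y\<^sup>2 * ((p - y)\<^sup>2 + q\<^sup>2) = (- y * (p - y) + r * q)\<^sup>2"
    and external: "x > 0 \<Longrightarrow> x * (p + x) + r * q < 0"
    and circum: "(z\<^sub>1 + x)\<^sup>2 + z\<^sub>2\<^sup>2 = R\<^sup>2" "(z\<^sub>1 - y)\<^sup>2 + z\<^sub>2\<^sup>2 = R\<^sup>2" "(z\<^sub>1 - p)\<^sup>2 + (z\<^sub>2 - q)\<^sup>2 = R\<^sup>2"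
    and nine: "(n\<^sub>1 - (y + p) / 2)\<^sup>2 + (n\<^sub>2 - q / 2)\<^sup>2 = \<rho>"
      "(n\<^sub>1 - (p - x) / 2)\<^sup>2 + (n\<^sub>2 - q / 2)\<^sup>2 = \<rho>" "(n\<^sub>1 - (y - x) / 2)\<^sup>2 + n\<^sub>2\<^sup>2 = \<rho>"
  shows "n\<^sub>1\<^sup>2 + (n\<^sub>2 - r)\<^sup>2 = (R / 2 + r)\<^sup>2"
proof -
  define D where "D = r\<^sup>2 - x * y"
  \<comment> \<open>Each tangency condition has the side \<open>AB\<close> itself, \<open>q = 0\<close>, as a solution;
     the other factor is linear in \<open>p\<close> and \<open>q\<close>.\<close>
  have "q * (q * (x\<^sup>2 - r\<^sup>2)) = q * (2 * x * r * (p + x))"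
    using tangentA by algebra
  then have tA: "q * (x\<^sup>2 - r\<^sup>2) = 2 * x * r * (p + x)" using q by simp
  have "q * (q * (y\<^sup>2 - r\<^sup>2)) = q * (2 * y * r * (y - p))"
    using tangentB by algebra
  then have tB: "q * (y\<^sup>2 - r\<^sup>2) = 2 * y * r * (y - p)" using q by simp
  have xy0: "x + y \<noteq> 0" using xy by simp
  have "x \<noteq> 0" using tA q r by auto
  then have x0: "x > 0" using x by simp
  have "y \<noteq> 0" using tB q r by auto
  then have y0: "y > 0" using y by simp
  \<comment> \<open>The tangency at \<open>A\<close> turns the sign given by the external bisector into the sign of \<open>q\<close>.\<close>
  have "q * (x * (x\<^sup>2 + r\<^sup>2)) = (2 * x * r) * (x * (p + x) + r * q)"
    using tA by algebra
  also have "\<dots> < 0" using external[OF x0] x0 r by (simp add: mult_pos_neg)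
  finally have "q * (x * (x\<^sup>2 + r\<^sup>2)) < 0" .
  moreover have "x * (x\<^sup>2 + r\<^sup>2) > 0" using x0 r by (simp add: add_pos_pos)
  ultimately have qneg: "q < 0" by (metis less_asym mult_less_0_iff)
  have "(x + y) * (q * D) = (x + y) * (- 2 * x * y * r)"
    using tA tB unfolding D_def by algebra
  then have qD: "q * D = - 2 * x * y * r" using xy0 mult_left_cancel by blast
  also have "\<dots> < 0" using x0 y0 r by simp
  finally have D0: "D > 0" using qneg by (simp add: mult_less_0_iff)
  have "(2 * x * r) * (p * D) = (2 * x * r) * (r\<^sup>2 * (y - x))"
    using tA qD unfolding D_def by algebra
  then have pD: "p * D = r\<^sup>2 * (y - x)" using x0 r by (simp only: mult_cancel_left) simp
  have "(x + y) * (2 * z\<^sub>1) = (x + y) * (y - x)"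
    using circum(1,2) by algebra
  then have z1: "2 * z\<^sub>1 = y - x" using xy0 mult_left_cancel by blast
  have qz: "2 * q * z\<^sub>2 = p\<^sup>2 + q\<^sup>2 - p * (y - x) - x * y"
    using circum(1,3) z1 by algebra
  have "2 * (q * D) * z\<^sub>2 * D = (2 * q * z\<^sub>2) * D\<^sup>2"
    by algebra
  also have "\<dots> = (p * D)\<^sup>2 + (q * D)\<^sup>2 - (p * D) * D * (y - x) - x * y * D\<^sup>2"
    unfolding qz by algebra
  also have "\<dots> = (x * y) * ((x + y)\<^sup>2 * r\<^sup>2 - D\<^sup>2)"
    unfolding qD pD unfolding D_def by algebra
  finally have "(x * y) * (4 * r * D * z\<^sub>2) = (x * y) * (D\<^sup>2 - (x + y)\<^sup>2 * r\<^sup>2)"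
    unfolding qD by (simp add: algebra_simps)
  then have z2: "4 * r * D * z\<^sub>2 = D\<^sup>2 - (x + y)\<^sup>2 * r\<^sup>2" using x0 y0 by (simp only: mult_cancel_left) simp
  \<comment> \<open>\<open>R\<^sup>2\<close> is a perfect square because \<open>4 D\<^sup>2 m + (D\<^sup>2 - m)\<^sup>2 = (D\<^sup>2 + m)\<^sup>2\<close> with \<open>m = (x + y)\<^sup>2 r\<^sup>2\<close>.\<close>
  have "4 * R\<^sup>2 = (x + y)\<^sup>2 + 4 * z\<^sub>2\<^sup>2"
    using circum(1) z1 by algebra
  then have "(4 * r * D * R)\<^sup>2 = 4 * D\<^sup>2 * ((x + y)\<^sup>2 * r\<^sup>2) + (4 * r * D * z\<^sub>2)\<^sup>2"
    by algebra
  also have "\<dots> = (D\<^sup>2 + (x + y)\<^sup>2 * r\<^sup>2)\<^sup>2"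
    unfolding z2 by algebra
  finally have "(4 * r * D * R)\<^sup>2 = (D\<^sup>2 + (x + y)\<^sup>2 * r\<^sup>2)\<^sup>2" .
  then have Rv: "4 * r * D * R = D\<^sup>2 + (x + y)\<^sup>2 * r\<^sup>2"
    using D0 r R by (simp add: power2_eq_iff_nonneg)
  \<comment> \<open>The nine-point center is the midpoint of the circumcenter \<open>Z\<close> and the orthocenter
     \<open>A + B + C - 2 Z\<close>, hence \<open>2 N = A + B + C - Z\<close>; both coordinates follow this pattern.\<close>
  have "(x + y) * (2 * n\<^sub>1) = (x + y) * (p + (y - x) / 2)"
    using nine(1,2) by (simp add: power2_eq_square field_simps)
  then have n1: "2 * n\<^sub>1 = p + (y - x) / 2" using xy0 mult_left_cancel by blast
  have "q * (2 * n\<^sub>2) = q * (q - z\<^sub>2)"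
  proof -
    have "q * n\<^sub>2 - q\<^sup>2 / 4 = (n\<^sub>1 - (y + p) / 2)\<^sup>2 - (n\<^sub>1 - (y - x) / 2)\<^sup>2"
      using nine(1,3) by (simp add: power2_eq_square field_simps)
    also have "\<dots> = (2 * n\<^sub>1 - (2 * y + p - x) / 2) * (- (x + p) / 2)"
      by (simp add: power2_eq_square field_simps)
    also have "\<dots> = (x + p) * (y - p) / 4"
      unfolding n1 by (simp add: field_simps)
    finally have "4 * (q * n\<^sub>2) = q\<^sup>2 + (x + p) * (y - p)"
      by (simp add: field_simps)
    then show ?thesis
      using qz by algebra
  qed
  then have n2: "2 * n\<^sub>2 = q - z\<^sub>2" using q mult_left_cancel by blast
  have n1D: "8 * r * D * n\<^sub>1 = 2 * r * (y - x) * (2 * r\<^sup>2 + D)"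
    using n1 pD by algebra
  have n2D: "8 * r * D * (n\<^sub>2 - r) = - 8 * x * y * r\<^sup>2 - (D\<^sup>2 - (x + y)\<^sup>2 * r\<^sup>2) - 8 * r\<^sup>2 * D"
    using n2 qD z2 by algebra
  have "(8 * r * D)\<^sup>2 * (n\<^sub>1\<^sup>2 + (n\<^sub>2 - r)\<^sup>2) = (8 * r * D * n\<^sub>1)\<^sup>2 + (8 * r * D * (n\<^sub>2 - r))\<^sup>2"
    by algebra
  also have "\<dots> = (D\<^sup>2 + (x + y)\<^sup>2 * r\<^sup>2 + 8 * r\<^sup>2 * D)\<^sup>2"
    unfolding n1D n2D unfolding D_def by algebra
  also have "\<dots> = (4 * r * D * R + 8 * r\<^sup>2 * D)\<^sup>2"
    unfolding Rv ..
  also have "\<dots> = (8 * r * D)\<^sup>2 * (R / 2 + r)\<^sup>2"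
    by (simp add: power2_eq_square field_simps)
  finally show ?thesis using D0 r by (simp only: mult_cancel_left) simp
qed

theorem theorem3:
  fixes A B C N I\<^sub>c :: "real ^ 2" and R r\<^sub>c :: real
  assumes "\<not> collinear {A, B, C}"
    and "is_circumradius A B C R"
    and "is_nine_point_center A B C N"
    and "is_excenter A B C I\<^sub>c"
    and "is_excircle A B C I\<^sub>c r\<^sub>c"
  shows "dist I\<^sub>c N = R / 2 + r\<^sub>c"
proof -
  obtain T where touch: "circle_touches_at I\<^sub>c r\<^sub>c (affine hull {A, B}) T"
    and T: "T \<in> closed_segment A B"
    using assms(5) unfolding is_excircle_def by blast
  obtain T\<^sub>A T\<^sub>B where touchA: "circle_touches_at I\<^sub>c r\<^sub>c (affine hull {A, C}) T\<^sub>A"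
    and touchB: "circle_touches_at I\<^sub>c r\<^sub>c (affine hull {B, C}) T\<^sub>B"
    using assms(5) unfolding is_excircle_def by (auto simp: insert_commute)
  obtain Z where Z: "dist Z A = R" "dist Z B = R" "dist Z C = R"
    using assms(2) by (auto simp: is_circumradius_def)
  obtain \<rho> where N: "dist N (midpoint B C) = \<rho>" "dist N (midpoint C A) = \<rho>" "dist N (midpoint A B) = \<rho>"
    using assms(3) by (auto simp: is_nine_point_center_def)
  have ext: "I\<^sub>c \<in> external_angle_bisector B A C"
    using assms(4) by (auto simp: is_excenter_def)
  have ne: "A \<noteq> B" "A \<noteq> C" "B \<noteq> C"
    using assms(1) by (auto simp: insert_commute)
  have r: "r\<^sub>c > 0" and rT: "dist I\<^sub>c T = r\<^sub>c"
    using touch by (auto simp: circle_touches_at_def)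
  have R: "R \<ge> 0" using Z(1) by auto
  define c where "c = norm (B - A)"
  have c: "c > 0" using ne by (simp add: c_def)
  obtain s where s: "0 \<le> s" "s \<le> 1" "T = A + s *\<^sub>R (B - A)"
    using T by (auto simp: in_segment algebra_simps)
  define e where "e = (1 / c) *\<^sub>R (B - A)"
  define n where "n = (1 / r\<^sub>c) *\<^sub>R (I\<^sub>c - T)"
  define x where "x = s * c"
  define y where "y = (1 - s) * c"
  have BA: "B - A = c *\<^sub>R e" using c by (simp add: e_def)
  have A: "A = T - x *\<^sub>R e" using s BA by (simp add: x_def)
  have B: "B = T + y *\<^sub>R e" using s BA by (simp add: y_def algebra_simps)
  have I: "I\<^sub>c = T + r\<^sub>c *\<^sub>R n" using r by (simp add: n_def)
  have ee: "e \<bullet> e = 1"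
    using c by (simp add: e_def c_def flip: power2_norm_eq_inner)
  have nn: "n \<bullet> n = 1"
    using r rT by (simp add: n_def dist_norm flip: power2_norm_eq_inner)
  have en: "e \<bullet> n = 0"
    using circle_touches_at_orthogonal[OF touch]
    by (simp add: e_def n_def inner_commute inner_diff_left inner_diff_right)
  have ne0: "n \<bullet> e = 0" using en by (simp add: inner_commute)
  note expand = inner_orthonormal_real2[OF ee nn en]
  \<comment> \<open>The point with coordinates \<open>(u, v)\<close> in the frame with origin \<open>T\<close> and axes \<open>e\<close> and \<open>n\<close>.\<close>
  define pt where "pt u v = T + u *\<^sub>R e + v *\<^sub>R n" for u v
  have inner_pt: "(pt u v - pt u' v') \<bullet> (pt a b - pt a' b') = (u - u') * (a - a') + (v - v') * (b - b')"
    for u v u' v' a b a' b'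
    using ee nn en ne0 by (simp add: pt_def inner_simps algebra_simps)
  have pt_ex: "\<exists>u v. X = pt u v" for X
  proof -
    define u v where "u = (X - T) \<bullet> e" and "v = (X - T) \<bullet> n"
    have "(X - pt u v) \<bullet> e = 0" "(X - pt u v) \<bullet> n = 0"
      using ee nn en ne0 by (simp_all add: pt_def u_def v_def inner_simps)
    then have "(X - pt u v) \<bullet> (X - pt u v) = 0"
      using expand[of "X - pt u v" "X - pt u v"] by simp
    then show ?thesis by auto
  qed
  have dist_pt: "(dist (pt u v) (pt u' v'))\<^sup>2 = (u - u')\<^sup>2 + (v - v')\<^sup>2" for u v u' v'
    unfolding dist_norm power2_norm_eq_inner inner_pt by (simp add: power2_eq_square)
  have mid_pt: "midpoint (pt u v) (pt u' v') = pt ((u + u') / 2) ((v + v') / 2)" for u v u' v'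
    by (simp add: midpoint_def pt_def vec_eq_iff field_simps)
  have Ap: "A = pt (- x) 0" and Bp: "B = pt y 0" and Ip: "I\<^sub>c = pt 0 r\<^sub>c"
    using A B I by (simp_all add: pt_def)
  obtain p q where Cp: "C = pt p q" using pt_ex by blast
  obtain z\<^sub>1 z\<^sub>2 where Zp: "Z = pt z\<^sub>1 z\<^sub>2" using pt_ex by blast
  obtain n\<^sub>1 n\<^sub>2 where Np: "N = pt n\<^sub>1 n\<^sub>2" using pt_ex by blast
  have xy: "x \<ge> 0" "y \<ge> 0" "x + y = c" using s c by (simp_all add: x_def y_def algebra_simps)
  have q: "q \<noteq> 0"
  proof
    assume "q = 0"
    have "C - A = ((p + x) / c) *\<^sub>R (B - A)"
      using \<open>q = 0\<close> c unfolding BA by (simp add: Cp Ap pt_def flip: scaleR_add_left)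
    then have "collinear {0, B - A, C - A}"
      by (auto simp: collinear_lemma)
    then have "collinear {A, B, C}"
      using collinear_3[of B A C] by (simp add: insert_commute)
    then show False using assms(1) by simp
  qed
  have external: "x * (p + x) + r\<^sub>c * q < 0" if "x > 0"
  proof -
    have "x * c / c = - (x * (p + x) + r\<^sub>c * q) / norm (C - A)"
      using external_angle_bisector_inner[OF ext] ne xy(3)
      unfolding c_def[symmetric] by (simp add: Ap Bp Ip Cp inner_pt add.commute)
    then have "- (x * (p + x) + r\<^sub>c * q) / norm (C - A) > 0"
      using that c by simp
    then show ?thesis using ne by (simp add: zero_less_divide_iff)
  qed
  have "n\<^sub>1\<^sup>2 + (n\<^sub>2 - r\<^sub>c)\<^sup>2 = (R / 2 + r\<^sub>c)\<^sup>2"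
  proof (rule dist_excenter_nine_point_center_coords[OF xy(1,2) _ r q R _ _ external])
    show "0 < x + y" using c xy by simp
    show "x\<^sup>2 * ((p + x)\<^sup>2 + q\<^sup>2) = (x * (p + x) + r\<^sub>c * q)\<^sup>2"
      using circle_touches_line_inner[OF touchA] unfolding Ap Ip Cp inner_pt
      by (simp add: power2_eq_square)
    show "y\<^sup>2 * ((p - y)\<^sup>2 + q\<^sup>2) = (- y * (p - y) + r\<^sub>c * q)\<^sup>2"
      using circle_touches_line_inner[OF touchB] unfolding Bp Ip Cp inner_pt
      by (simp add: power2_eq_square)
    show "(z\<^sub>1 + x)\<^sup>2 + z\<^sub>2\<^sup>2 = R\<^sup>2" "(z\<^sub>1 - y)\<^sup>2 + z\<^sub>2\<^sup>2 = R\<^sup>2" "(z\<^sub>1 - p)\<^sup>2 + (z\<^sub>2 - q)\<^sup>2 = R\<^sup>2"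
      using Z[THEN arg_cong[where f = "\<lambda>t. t\<^sup>2"]] unfolding Zp Ap Bp Cp dist_pt by simp_all
    show "(n\<^sub>1 - (y + p) / 2)\<^sup>2 + (n\<^sub>2 - q / 2)\<^sup>2 = \<rho>\<^sup>2"
      "(n\<^sub>1 - (p - x) / 2)\<^sup>2 + (n\<^sub>2 - q / 2)\<^sup>2 = \<rho>\<^sup>2" "(n\<^sub>1 - (y - x) / 2)\<^sup>2 + n\<^sub>2\<^sup>2 = \<rho>\<^sup>2"
      using N[THEN arg_cong[where f = "\<lambda>t. t\<^sup>2"]] unfolding Np Ap Bp Cp mid_pt dist_pt
      by (simp_all add: add.commute)
  qed
  then have "(dist I\<^sub>c N)\<^sup>2 = (R / 2 + r\<^sub>c)\<^sup>2"
    unfolding Ip Np dist_pt by (simp add: power2_commute)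
  then show ?thesis
    using R r by (simp add: power2_eq_iff_nonneg)
qed

end
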